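(* Let $p,q$ be natural numbers and let $T=T_v$ with $v=\{(p_n,\ell_n,q_n,m_n):n\in\mathbb N\}\in\mathcal W$. Suppose that for every pair $k,\ell\in\mathbb N$ the set $$\Big\{n\in\mathbb N:\ \frac{q_n+\ell}{q}=\frac{p_n+k}{p}\in\mathbb N\Big\}$$ is infinite. Then $T^p\times T^q$ and $T^{-p}\times T^q$ are conservative and ergodic (with respect to $\mu\times\mu$).
   Context: Rank-one construction (cutting and stacking): let $a_n,b_n,c_n,d_n$ ($n\ge 0$) be sequences of positive integers. Let $G_0$ be the unit interval $[0,1)$, a column of height $H_0=1$ (set $h_0=1$). Given the column $G_n$ of height $H_n$ (a stack of intervals, each level mapped to the one above by translation), form $G_{n+1}$ by cutting $G_n$ into four subcolumns of equal width, placing $a_n,b_n,c_n,d_n$ new intervals ("spacers") on top of the first, second, third and fourth subcolumns respectively, and stacking the subcolumns from left to right (each subcolumn with its spacers placed on top of the previous one). This defines a Lebesgue-measure-preserving invertible transformation $T$ on a subset of $\mathbb R$ with Lebesgue measure $\mu$. Put $p_n=H_n+a_n$, $\ell_n=H_n+b_n$, $q_n=H_n+c_n$, $m_n=H_n+d_n$ and $h_{n+1}=p_n+\ell_n+q_n+H_n$ (so $H_{n+1}=p_n+\ell_n+q_n+m_n$). Write $T=T_v$ with $v=\{(p_n,\ell_n,q_n,m_n):n\in\mathbb N\}$. $\mathcal W$ is the set of such $v$ satisfying $\lim_{n\to\infty}p_n/h_n=\infty$, $\ell_n>n(p_n+q_n+2h_n)$ and $m_n>n(p_n+q_n+H_n+\ell_n)=n\,h_{n+1}$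 for all $n$. A measure-preserving $S$ is conservative if for every set $A$ of positive measure there is $n\ge1$ with $\mu(S^{-n}A\cap A)>0$. *)

theory Defs
  imports "HOL-Analysis.Analysis"
begin

text \<open>Rank-one cutting-and-stacking construction with four subcolumns.
  The parameters a, b, c, d :: nat => nat are the spacer counts a_n, b_n, c_n, d_n.
  Concrete realisation: G_0 = [0,1); the spacers added at stage n are laid out
  consecutively, each of width 4^-(n+1), to the right of the union [0, L n) of the
  levels of G_n, in the order (spacers over subcolumn 0, 1, 2, 3), bottom to top.\<close>

fun H :: "(nat \<Rightarrow> nat) \<Rightarrow> (nat \<Rightarrow> nat) \<Rightarrow> (nat \<Rightarrow> nat) \<Rightarrow> (nat \<Rightarrow> nat) \<Rightarrow> nat \<Rightarrow> nat" where
  "H a b c d 0 = 1"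
| "H a b c d (Suc n) = 4 * H a b c d n + a n + b n + c n + d n"

definition pp where "pp a b c d n = H a b c d n + a n"
definition ll where "ll a b c d n = H a b c d n + b n"
definition qq where "qq a b c d n = H a b c d n + c n"
definition mm where "mm a b c d n = H a b c d n + d n"

fun h :: "(nat \<Rightarrow> nat) \<Rightarrow> (nat \<Rightarrow> nat) \<Rightarrow> (nat \<Rightarrow> nat) \<Rightarrow> (nat \<Rightarrow> nat) \<Rightarrow> nat \<Rightarrow> nat" where
  "h a b c d 0 = 1"
| "h a b c d (Suc n) = pp a b c d n + ll a b c d n + qq a b c d n + H a b c d n"

definition inW :: "(nat \<Rightarrow> nat) \<Rightarrow> (nat \<Rightarrow> nat) \<Rightarrow> (nat \<Rightarrow> nat) \<Rightarrow> (nat \<Rightarrow> nat) \<Rightarrow> bool" where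
  "inW a b c d \<longleftrightarrow>
     filterlim (\<lambda>n. real (pp a b c d n) / real (h a b c d n)) at_top sequentially \<and>
     (\<forall>n. ll a b c d n > n * (pp a b c d n + qq a b c d n + 2 * h a b c d n)) \<and>
     (\<forall>n. mm a b c d n > n * h a b c d (Suc n))"

definition wd :: "nat \<Rightarrow> real" where "wd n = (1/4) ^ n"

definition Ln :: "(nat \<Rightarrow> nat) \<Rightarrow> (nat \<Rightarrow> nat) \<Rightarrow> (nat \<Rightarrow> nat) \<Rightarrow> (nat \<Rightarrow> nat) \<Rightarrow> nat \<Rightarrow> real" where
  "Ln a b c d n = real (H a b c d n) * wd n"

text \<open>Left endpoint of level j (0 <= j < H n) of column G_n; level j is [lev n j, lev n j + wd n).\<close>
fun lev :: "(nat \<Rightarrow> nat) \<Rightarrow> (nat \<Rightarrow> nat) \<Rightarrow> (nat \<Rightarrow> nat) \<Rightarrow> (nat \<Rightarrow> nat) \<Rightarrow> nat \<Rightarrow> nat \<Rightarrow> real" where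
  "lev a b c d 0 j = 0"
| "lev a b c d (Suc n) j =
    (let Hn = H a b c d n;
         B1 = Hn + a n; B2 = B1 + Hn + b n; B3 = B2 + Hn + c n;
         (i, r, sp) = (if j < B1 then (0::nat, j, 0::nat)
                       else if j < B2 then (1, j - B1, a n)
                       else if j < B3 then (2, j - B2, a n + b n)
                       else (3, j - B3, a n + b n + c n))
     in if r < Hn then lev a b c d n r + real i * wd (Suc n)
        else Ln a b c d n + real (sp + (r - Hn)) * wd (Suc n))"

definition in_level where
  "in_level a b c d n j x \<longleftrightarrow> j < H a b c d n \<and> lev a b c d n j \<le> x \<and> x < lev a b c d n j + wd n"

text \<open>The transformation T: translation of a non-top level onto the level above it
  (independent of the column used). Points lying in no non-top level (none exist in X)
  are fixed.\<close>
definition Tmap :: "(nat \<Rightarrow> nat) \<Rightarrow> (nat \<Rightarrow> nat) \<Rightarrow> (nat \<Rightarrow> nat) \<Rightarrow> (nat \<Rightarrow> nat) \<Rightarrow> real \<Rightarrow> real" where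
  "Tmap a b c d x =
    (if \<exists>n j. Suc j < H a b c d n \<and> in_level a b c d n j x
     then (let (n, j) = (SOME (n, j). Suc j < H a b c d n \<and> in_level a b c d n j x)
           in x + lev a b c d n (Suc j) - lev a b c d n j)
     else x)"

definition Tinv :: "(nat \<Rightarrow> nat) \<Rightarrow> (nat \<Rightarrow> nat) \<Rightarrow> (nat \<Rightarrow> nat) \<Rightarrow> (nat \<Rightarrow> nat) \<Rightarrow> real \<Rightarrow> real" where
  "Tinv a b c d x =
    (if \<exists>n j. 0 < j \<and> in_level a b c d n j x
     then (let (n, j) = (SOME (n, j). 0 < j \<and> in_level a b c d n j x)
           in x + lev a b c d n (j - 1) - lev a b c d n j)
     else x)"

definition Xsp where "Xsp a b c d = (\<Union>n. {0..<Ln a b c d n})"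

definition muX where "muX a b c d = restrict_space lebesgue (Xsp a b c d)"

definition conservative :: "'a measure \<Rightarrow> ('a \<Rightarrow> 'a) \<Rightarrow> bool" where
  "conservative M S \<longleftrightarrow>
     (\<forall>A \<in> sets M. emeasure M A > 0 \<longrightarrow>
        (\<exists>n\<ge>1. emeasure M ((S ^^ n) -` A \<inter> A) > 0))"

definition ergodic :: "'a measure \<Rightarrow> ('a \<Rightarrow> 'a) \<Rightarrow> bool" where
  "ergodic M S \<longleftrightarrow>
     (\<forall>A \<in> sets M. S -` A \<inter> space M = A \<longrightarrow>
        emeasure M A = 0 \<or> emeasure M (space M - A) = 0)"

end

theory Submission
  imports Defs
begin

text \<open>
  Call a map \<open>S\<close> transitive if for all sets \<open>A\<close>, \<open>B\<close> of positive measure some \<open>S\<^sup>-\<^sup>r B\<close> with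
  \<open>r \<ge> 1\<close> meets \<open>A\<close> in positive measure; a transitive map is conservative and ergodic.
  The levels of \<open>G\<^sub>n\<close> are exactly the intervals \<open>[k 4\<^sup>-\<^sup>n, (k+1) 4\<^sup>-\<^sup>n)\<close> in \<open>[0, L\<^sub>n)\<close>, so by outer
  regularity \<open>A\<close> and \<open>B\<close> nearly fill products \<open>I \<times> J\<close> and \<open>I' \<times> J'\<close> of levels of a common \<open>G\<^sub>n\<close>.
  Passing to suitable subcolumns of \<open>G\<^sub>n\<^sub>+\<^sub>1\<close> one may assume that \<open>J'\<close> lies \<open>l \<ge> 0\<close> levels
  above \<open>J\<close>, and that \<open>I'\<close> lies \<open>k \<ge> 0\<close> levels above \<open>I\<close> (below \<open>I\<close> for \<open>T\<^sup>-\<^sup>p \<times> T\<^sup>q\<close>).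
  If \<open>p r = p\<^sub>m + k\<close> and \<open>q r = q\<^sub>m + l\<close> with \<open>m \<ge> n\<close>, then \<open>S\<^sup>r\<close> moves every copy of \<open>I\<close> in the first
  subcolumn of \<open>G\<^sub>m\<close> times every copy of \<open>J\<close> in the third one by a translation onto the matching
  copies of \<open>I'\<close> in the second and of \<open>J'\<close> in the fourth subcolumn (for \<open>T\<^sup>-\<^sup>p \<times> T\<^sup>q\<close> the first two
  subcolumns are exchanged). These copies fill one sixteenth of \<open>I \<times> J\<close>, which is more than \<open>A\<close>
  and \<open>B\<close> together can miss.
\<close>

section \<open>Lebesgue measure on products\<close>

text \<open>Each factor is a Borel set up to a subset of a Borel null set. Hence the product differs
  from the Borel product \<open>S \<times> R\<close> only inside the two null strips
  \<open>N' \<times> UNIV\<close> and \<open>UNIV \<times> M'\<close>, and the product formula of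
  \<open>lborel\<close> carries over.\<close>

lemma lebesgue_Times:
  fixes A :: "'a::euclidean_space set" and B :: "'b::euclidean_space set"
  assumes A: "A \<in> sets lebesgue" and B: "B \<in> sets lebesgue"
  shows sets_lebesgue_Times: "A \<times> B \<in> sets lebesgue"
    and emeasure_lebesgue_Times:
      "emeasure lebesgue (A \<times> B) = emeasure lebesgue A * emeasure lebesgue B"
proof -
  obtain S N N' where S: "A = S \<union> N" "N \<subseteq> N'" "N' \<in> null_sets lborel" "S \<in> sets lborel"
    using sets_completionE[OF A] .
  obtain R M M' where R: "B = R \<union> M" "M \<subseteq> M'" "M' \<in> null_sets lborel" "R \<in> sets lborel"
    using sets_completionE[OF B] .
  have prod: "emeasure lborel (P \<times> Q) = emeasure lborel P * emeasure lborel Q"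
    if "P \<in> sets lborel" "Q \<in> sets lborel" for P :: "'a set" and Q :: "'b set"
    using lborel.emeasure_pair_measure_Times[OF that] by (simp add: lborel_prod)
  have meas: "P \<times> Q \<in> sets lborel"
    if "P \<in> sets lborel" "Q \<in> sets lborel" for P :: "'a set" and Q :: "'b set"
    using pair_measureI[OF that] by (simp only: lborel_prod)
  have "N' \<times> (UNIV :: 'b set) \<in> null_sets lborel" "(UNIV :: 'a set) \<times> M' \<in> null_sets lborel"
    using S(3) R(3) prod[of N' UNIV] prod[of UNIV M'] meas[of N' UNIV] meas[of UNIV M']
    by (auto simp: null_sets_def)
  then have "N' \<times> UNIV \<union> UNIV \<times> M' \<in> null_sets lborel"
    by (rule null_sets.Un)
  moreover have "A \<times> B - S \<times> R \<subseteq> N' \<times> UNIV \<union> UNIV \<times> M'"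
    using S R by auto
  ultimately have null: "A \<times> B - S \<times> R \<in> null_sets lebesgue"
    unfolding null_sets_completion_iff2 by blast
  have SR: "S \<times> R \<in> sets lborel"
    using meas S(4) R(4) by blast
  then have SR': "S \<times> R \<in> sets lebesgue" by simp
  have eq: "A \<times> B = S \<times> R \<union> (A \<times> B - S \<times> R)"
    using S R by auto
  show "A \<times> B \<in> sets lebesgue"
    using SR' null eq null_setsD2 sets.Un by metis
  have "N \<in> null_sets lebesgue" "M \<in> null_sets lebesgue"
    using S(2,3) R(2,3) null_sets_completion_iff2 by blast+
  then have "emeasure lebesgue A = emeasure lborel S" "emeasure lebesgue B = emeasure lborel R"
    using S(1,4) R(1,4) by (simp_all add: emeasure_Un_null_set)
  moreover have "emeasure lebesgue (A \<times> B) = emeasure lborel (S \<times> R)"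
    using emeasure_Un_null_set[OF SR' null] eq SR by simp
  ultimately show "emeasure lebesgue (A \<times> B) = emeasure lebesgue A * emeasure lebesgue B"
    using prod S(4) R(4) by simp
qed

lemma sigma_finite_lebesgue: "sigma_finite_measure (lebesgue :: 'a::euclidean_space measure)"
proof
  obtain \<A> :: "'a set set" where "countable \<A>" "\<A> \<subseteq> sets lborel" "\<Union>\<A> = space lborel"
      "\<forall>P\<in>\<A>. emeasure lborel P \<noteq> \<infinity>"
    using lborel.sigma_finite_countable by blast
  then show "\<exists>\<A> :: 'a set set. countable \<A> \<and> \<A> \<subseteq> sets lebesgue \<and> \<Union>\<A> = space lebesgue \<and>
      (\<forall>P\<in>\<A>. emeasure lebesgue P \<noteq> \<infinity>)"
    by (intro exI[of _ \<A>]) auto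
qed

text \<open>A product of two complete measures need not be complete, so it is compared with Lebesgue
  measure rather than identified with it. The identity from the restricted Lebesgue space on
  \<open>X \<times> Y\<close> to the product is measurable, and its image measure agrees with the
  product measure on rectangles, hence everywhere by sigma-finiteness. This makes outer regularity
  in the plane available.\<close>

lemma restrict_lebesgue_pair:
  fixes X :: "'a::euclidean_space set" and Y :: "'b::euclidean_space set"
  assumes X: "X \<in> sets lebesgue" and Y: "Y \<in> sets lebesgue"
    and A: "A \<in> sets (restrict_space lebesgue X \<Otimes>\<^sub>M restrict_space lebesgue Y)"
  shows sets_restrict_lebesgue_pair: "A \<in> sets lebesgue"
    and emeasure_restrict_lebesgue_pair:
      "emeasure (restrict_space lebesgue X \<Otimes>\<^sub>M restrict_space lebesgue Y) A = emeasure lebesgue A"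
proof -
  let ?P = "restrict_space lebesgue X \<Otimes>\<^sub>M restrict_space lebesgue Y"
  let ?L = "restrict_space lebesgue (X \<times> Y)"
  have XY: "X \<times> Y \<in> sets lebesgue"
    using X Y by (rule sets_lebesgue_Times)
  have rect: "P \<times> Q \<in> sets lebesgue" "P \<times> Q \<subseteq> X \<times> Y"
      "emeasure lebesgue (P \<times> Q) = emeasure (restrict_space lebesgue X) P * emeasure (restrict_space lebesgue Y) Q"
    if "P \<in> sets (restrict_space lebesgue X)" "Q \<in> sets (restrict_space lebesgue Y)" for P Q
    using that X Y
    by (auto simp: sets_restrict_space_iff emeasure_restrict_space sets_lebesgue_Times emeasure_lebesgue_Times
        simp del: emeasure_completion)
  have id: "(\<lambda>z. z) \<in> measurable ?L ?P"
  proof (rule measurable_pair)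
    show "fst \<circ> (\<lambda>z. z) \<in> measurable ?L (restrict_space lebesgue X)"
    proof (rule measurableI)
      fix P assume P: "P \<in> sets (restrict_space lebesgue X)"
      have "(fst \<circ> (\<lambda>z. z)) -` P \<inter> space ?L = P \<times> Y"
        using sets.sets_into_space[OF P] by (auto simp: space_restrict_space)
      moreover have "P \<times> Y \<in> sets ?L"
        using rect[OF P, of Y] Y XY by (auto simp: sets_restrict_space_iff)
      ultimately show "(fst \<circ> (\<lambda>z. z)) -` P \<inter> space ?L \<in> sets ?L" by simp
    qed (auto simp: space_restrict_space)
    show "snd \<circ> (\<lambda>z. z) \<in> measurable ?L (restrict_space lebesgue Y)"
    proof (rule measurableI)
      fix Q assume Q: "Q \<in> sets (restrict_space lebesgue Y)"
      have "(snd \<circ> (\<lambda>z. z)) -` Q \<inter> space ?L = X \<times> Q"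
        using sets.sets_into_space[OF Q] by (auto simp: space_restrict_space)
      moreover have "X \<times> Q \<in> sets ?L"
        using rect[OF _ Q, of X] X XY by (auto simp: sets_restrict_space_iff)
      ultimately show "(snd \<circ> (\<lambda>z. z)) -` Q \<inter> space ?L \<in> sets ?L" by simp
    qed (auto simp: space_restrict_space)
  qed
  have sub: "B \<in> sets ?L" if "B \<in> sets ?P" for B
  proof -
    have "(\<lambda>z. z) -` B \<inter> space ?L = B"
      using sets.sets_into_space[OF that] by (auto simp: space_restrict_space space_pair_measure)
    then show ?thesis
      using measurable_sets[OF id that] by simp
  qed
  then show *: "A \<in> sets lebesgue"
    using A XY by (auto simp: sets_restrict_space_iff)
  have dist: "emeasure (distr ?L ?P (\<lambda>z. z)) B = emeasure lebesgue B" if "B \<in> sets ?P" for B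
  proof -
    have "B \<subseteq> X \<times> Y"
      using sets.sets_into_space[OF that] by (auto simp: space_restrict_space space_pair_measure)
    then have "(\<lambda>z. z) -` B \<inter> space ?L = B"
      by (auto simp: space_restrict_space)
    then show ?thesis
      using XY \<open>B \<subseteq> X \<times> Y\<close> by (simp add: emeasure_distr[OF id that] emeasure_restrict_space del: emeasure_completion)
  qed
  have sf: "sigma_finite_measure (restrict_space lebesgue X)"
      "sigma_finite_measure (restrict_space lebesgue Y)"
    using X Y by (auto intro!: sigma_finite_measure_restrict_space sigma_finite_lebesgue)
  have "?P = distr ?L ?P (\<lambda>z. z)"
  proof (rule pair_measure_eqI[OF sf])
    fix P Q assume PQ: "P \<in> sets (restrict_space lebesgue X)" "Q \<in> sets (restrict_space lebesgue Y)"
    then have "P \<times> Q \<in> sets ?P" by (rule pair_measureI)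
    then show "emeasure (restrict_space lebesgue X) P * emeasure (restrict_space lebesgue Y) Q
        = emeasure (distr ?L ?P (\<lambda>z. z)) (P \<times> Q)"
      using dist rect(3)[OF PQ] by simp
  qed simp
  then show "emeasure ?P A = emeasure lebesgue A"
    using dist[OF A] by simp
qed

section \<open>Criteria for measurability, conservativity and ergodicity\<close>

text \<open>On each piece the preimage of \<open>B\<close> is a translate of \<open>B\<close>, and
  countably many pieces cover \<open>X\<close>.\<close>

lemma piecewise_translation_measurable:
  fixes f :: "'a::euclidean_space \<Rightarrow> 'a"
  assumes X: "X \<in> sets lebesgue" and f: "f \<in> X \<rightarrow> X"
    and "countable \<P>" "X \<subseteq> \<Union>\<P>" "\<P> \<subseteq> sets lebesgue"
    and shift: "\<And>P. P \<in> \<P> \<Longrightarrow> \<exists>v. \<forall>x\<in>P. f x = x + v"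
  shows "f \<in> measurable (restrict_space lebesgue X) (restrict_space lebesgue X)"
proof (rule measurableI)
  show "f x \<in> space (restrict_space lebesgue X)" if "x \<in> space (restrict_space lebesgue X)" for x
    using that f by (auto simp: space_restrict_space)
  fix B assume "B \<in> sets (restrict_space lebesgue X)"
  then have B: "B \<in> sets lebesgue"
    using X by (simp add: sets_restrict_space_iff)
  obtain v where v: "\<And>P x. P \<in> \<P> \<Longrightarrow> x \<in> P \<Longrightarrow> f x = x + v P"
    using shift by metis
  have "f -` B \<inter> X = (\<Union>P\<in>\<P>. P \<inter> (+) (- v P) ` B) \<inter> X"
  proof
    show "f -` B \<inter> X \<subseteq> (\<Union>P\<in>\<P>. P \<inter> (+) (- v P) ` B) \<inter> X"
    proof
      fix x assume x: "x \<in> f -` B \<inter> X"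
      then obtain P where P: "P \<in> \<P>" "x \<in> P"
        using assms(4) by auto
      then have "x = - v P + f x"
        using v by simp
      then show "x \<in> (\<Union>P\<in>\<P>. P \<inter> (+) (- v P) ` B) \<inter> X"
        using P x by blast
    qed
    show "(\<Union>P\<in>\<P>. P \<inter> (+) (- v P) ` B) \<inter> X \<subseteq> f -` B \<inter> X"
      using v by fastforce
  qed
  moreover have "(\<Union>P\<in>\<P>. P \<inter> (+) (- v P) ` B) \<in> sets lebesgue"
    using assms(3,5) lebesgue_sets_translation[OF B]
    by (intro sets.countable_UN' sets.Int) blast+
  ultimately have "f -` B \<inter> X \<in> sets lebesgue"
    using X by auto
  then show "f -` B \<inter> space (restrict_space lebesgue X) \<in> sets (restrict_space lebesgue X)"
    using X by (simp add: space_restrict_space sets_restrict_space_iff)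
qed

text \<open>Conservativity is the case \<open>B = A\<close>. An invariant \<open>A\<close> contains
  the forward orbits of its points, so no preimage of its complement meets it; transitivity then
  forbids both from having positive measure.\<close>

lemma conservative_ergodic_if_transitive:
  assumes S: "S \<in> measurable M M"
    and trans: "\<And>A B. A \<in> sets M \<Longrightarrow> B \<in> sets M \<Longrightarrow> emeasure M A > 0 \<Longrightarrow> emeasure M B > 0 \<Longrightarrow>
      \<exists>r\<ge>1. emeasure M ((S ^^ r) -` B \<inter> A) > 0"
  shows "conservative M S" "ergodic M S"
proof -
  show "conservative M S"
    using trans by (auto simp: conservative_def)
  show "ergodic M S"
    unfolding ergodic_def
  proof (intro ballI impI)
    fix A assume A: "A \<in> sets M" and inv: "S -` A \<inter> space M = A"
    have stay: "(S ^^ r) x \<in> A" if "x \<in> A" for r x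
      using that inv by (induction r) auto
    show "emeasure M A = 0 \<or> emeasure M (space M - A) = 0"
    proof (rule ccontr)
      assume "\<not> ?thesis"
      then obtain r where "emeasure M ((S ^^ r) -` (space M - A) \<inter> A) > 0"
        using trans[of A "space M - A"] A by (auto simp: zero_less_iff_neq_zero)
      moreover have "(S ^^ r) -` (space M - A) \<inter> A = {}"
        using stay by auto
      ultimately show False by simp
    qed
  qed
qed

lemma map_prod_funpow:
  fixes f :: "'a \<Rightarrow> 'a" and g :: "'b \<Rightarrow> 'b"
  shows "map_prod f g ^^ r = map_prod (f ^^ r) (g ^^ r)"
  by (induction r) (simp_all add: fun_eq_iff)

section \<open>Columns, levels and copies of earlier columns\<close>

lemma wd_pos: "0 < wd n"
  by (simp add: wd_def)

lemma wd_Suc: "wd n = 4 * wd (Suc n)"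
  by (simp add: wd_def)

lemma less_4_cases: "i < 4 \<Longrightarrow> i = 0 \<or> i = 1 \<or> i = 2 \<or> i = (3::nat)"
  by auto

locale rank_one =
  fixes a b c d :: "nat \<Rightarrow> nat"
  assumes d_pos: "\<And>n. d n > 0"
begin

abbreviation Ht :: "nat \<Rightarrow> nat" where "Ht \<equiv> H a b c d"
abbreviation lv :: "nat \<Rightarrow> nat \<Rightarrow> real" where "lv \<equiv> lev a b c d"
abbreviation T :: "real \<Rightarrow> real" where "T \<equiv> Tmap a b c d"
abbreviation T' :: "real \<Rightarrow> real" where "T' \<equiv> Tinv a b c d"
abbreviation X :: "real set" where "X \<equiv> Xsp a b c d"

definition lvl :: "nat \<Rightarrow> nat \<Rightarrow> real set" where
  "lvl n j = {lv n j ..< lv n j + wd n}"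

text \<open>The height in \<open>G\<^sub>n\<^sub>+\<^sub>1\<close> of the bottom of the subcolumn \<open>i < 4\<close> of \<open>G\<^sub>n\<close>.\<close>
definition off :: "nat \<Rightarrow> nat \<Rightarrow> nat" where
  "off n i = i * Ht n + (if i = 0 then 0 else if i = 1 then a n else if i = 2 then a n + b n
     else a n + b n + c n)"

lemma in_level_iff: "in_level a b c d n j x \<longleftrightarrow> j < Ht n \<and> x \<in> lvl n j"
  by (auto simp: in_level_def lvl_def)

lemma Ht_pos: "0 < Ht n"
  by (induction n) auto

text \<open>The spacer guaranteed by \<open>d_pos\<close> lies above the last subcolumn, so no copy
  of a level of \<open>G\<^sub>n\<close> is the top level of
  \<open>G\<^sub>n\<^sub>+\<^sub>1\<close>. This is why every point eventually lies in a non-top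
  level.\<close>

lemma off_less: "i < 4 \<Longrightarrow> r < Ht n \<Longrightarrow> Suc (off n i + r) < Ht (Suc n)"
  using d_pos[of n] by (auto dest!: less_4_cases simp: off_def)

lemma lev_off: "i < 4 \<Longrightarrow> r < Ht n \<Longrightarrow> lv (Suc n) (off n i + r) = lv n r + real i * wd (Suc n)"
  by (auto dest!: less_4_cases simp: off_def Let_def)

text \<open>For \<open>k < 4 * Ht n\<close>, the cell \<open>k\<close> of the finer grid is the
  quarter \<open>k mod 4\<close> of the cell \<open>k div 4\<close> of the coarser one. The
  remaining cells are the new spacers, laid out from \<open>Ln a b c d n\<close> to the
  right.\<close>

lemma lev_attained: "k < Ht n \<Longrightarrow> \<exists>j<Ht n. lv n j = real k * wd n"
proof (induction n arbitrary: k)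
  case 0
  then show ?case by simp
next
  case (Suc n)
  show ?case
  proof (cases "k < 4 * Ht n")
    case True
    then have "k div 4 < Ht n" by auto
    then obtain r where r: "r < Ht n" "lv n r = real (k div 4) * wd n"
      using Suc.IH by blast
    have "real (k div 4) * 4 + real (k mod 4) = real k"
      by (metis div_mult_mod_eq of_nat_add of_nat_mult of_nat_numeral)
    then have "lv (Suc n) (off n (k mod 4) + r) = real k * wd (Suc n)"
      using r by (simp add: lev_off wd_Suc[of n] del: lev.simps) (simp add: algebra_simps flip: distrib_left)
    then show ?thesis
      using off_less[of "k mod 4" r n] r(1) by (intro exI[of _ "off n (k mod 4) + r"]) auto
  next
    case False
    define e where "e = k - 4 * Ht n"
    have k: "k = 4 * Ht n + e" and e: "e < a n + b n + c n + d n"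
      using False Suc.prems by (auto simp: e_def)
    \<comment> \<open>Below the spacer number \<open>e\<close> in the new column lie the
      \<open>e\<close> earlier spacers and between one and four full copies of
      \<open>G\<^sub>n\<close>.\<close>
    define j where "j = e + (if e < a n then 1 else if e < a n + b n then 2
      else if e < a n + b n + c n then 3 else 4) * Ht n"
    have "lv (Suc n) j = Ln a b c d n + real e * wd (Suc n)"
      by (auto simp: j_def Let_def)
    also have "\<dots> = real k * wd (Suc n)"
      by (simp add: k Ln_def wd_Suc[of n] algebra_simps)
    finally show ?thesis
      using e by (intro exI[of _ j]) (auto simp: j_def)
  qed
qed

text \<open>Pigeonhole: the \<open>Ht n\<close> levels attain all of the \<open>Ht n\<close> grid
  points, so they attain nothing else and each of them only once.\<close>

lemma lev_bij: "bij_betw (lv n) {..<Ht n} ((\<lambda>k. real k * wd n) ` {..<Ht n})"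
proof -
  let ?R = "(\<lambda>k. real k * wd n) ` {..<Ht n}"
  have "inj_on (\<lambda>k. real k * wd n) {..<Ht n}"
    using wd_pos[of n] by (intro inj_onI) auto
  then have cardR: "card ?R = Ht n"
    by (simp add: card_image)
  have sub: "?R \<subseteq> lv n ` {..<Ht n}"
    using lev_attained by (force simp: image_iff)
  have "card (lv n ` {..<Ht n}) = Ht n"
    using card_image_le[of "{..<Ht n}" "lv n"] card_mono[OF _ sub] cardR by simp
  then have "inj_on (lv n) {..<Ht n}" "?R = lv n ` {..<Ht n}"
    using cardR card_subset_eq[OF _ sub] by (simp_all add: eq_card_imp_inj_on)
  then show ?thesis
    by (simp add: bij_betw_def)
qed

lemma lvl_unique:
  assumes "i < Ht n" "j < Ht n" "x \<in> lvl n i" "x \<in> lvl n j"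
  shows "i = j"
proof -
  have "lv n i \<in> (\<lambda>k. real k * wd n) ` {..<Ht n}" "lv n j \<in> (\<lambda>k. real k * wd n) ` {..<Ht n}"
    using lev_bij[of n] assms by (auto simp: bij_betw_def)
  then obtain k l where kl: "lv n i = real k * wd n" "lv n j = real l * wd n"
    by auto
  have "real k * wd n < (real l + 1) * wd n" "real l * wd n < (real k + 1) * wd n"
    using assms(3,4) kl by (auto simp: lvl_def algebra_simps)
  then have "k = l"
    using wd_pos[of n] by simp
  then show ?thesis
    using kl assms lev_bij[of n] by (auto simp: bij_betw_def inj_on_def)
qed

lemma lvl_off_subset: "i < 4 \<Longrightarrow> r < Ht n \<Longrightarrow> lvl (Suc n) (off n i + r) \<subseteq> lvl n r"
  using wd_pos[of "Suc n"]
  by (auto dest!: less_4_cases simp: lvl_def lev_off wd_Suc[of n] simp del: lev.simps)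

lemma lvl_split:
  assumes "r < Ht n" "x \<in> lvl n r"
  obtains i where "i < 4" "x \<in> lvl (Suc n) (off n i + r)"
proof -
  define u where "u = (x - lv n r) / wd (Suc n)"
  have x: "x = lv n r + u * wd (Suc n)"
    using wd_pos[of "Suc n"] by (simp add: u_def)
  have u: "0 \<le> u" "u < 4"
    using assms wd_pos[of "Suc n"] by (auto simp: u_def lvl_def wd_Suc[of n] field_simps)
  define i where "i = nat \<lfloor>u\<rfloor>"
  have i: "real i \<le> u" "u < real i + 1"
    using u by (auto simp: i_def)
  then have i4: "i < 4" using u by linarith
  moreover have "x \<in> lvl (Suc n) (off n i + r)"
  proof -
    have "real i * wd (Suc n) \<le> u * wd (Suc n)" "u * wd (Suc n) < (real i + 1) * wd (Suc n)"
      using i wd_pos[of "Suc n"] by auto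
    then show ?thesis
      using assms i4 x by (auto simp: lvl_def lev_off distrib_right simp del: lev.simps)
  qed
  ultimately show ?thesis by (rule that)
qed

text \<open>\<open>D\<close> is the set of heights in \<open>G\<^sub>m\<close> at which a copy of \<open>G\<^sub>n\<close> starts.\<close>
lemma lvl_copies:
  assumes "n \<le> m"
  obtains D where "finite D"
    "\<And>s. s \<in> D \<Longrightarrow> \<exists>\<delta>. \<forall>r<Ht n. s + r < Ht m \<and> lv m (s + r) = lv n r + \<delta>"
    "\<And>r. r < Ht n \<Longrightarrow> lvl n r = (\<Union>s\<in>D. lvl m (s + r))"
proof -
  have "\<exists>D. finite D \<and> (\<forall>s\<in>D. \<exists>\<delta>. \<forall>r<Ht n. s + r < Ht m \<and> lv m (s + r) = lv n r + \<delta>) \<and>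
    (\<forall>r<Ht n. lvl n r = (\<Union>s\<in>D. lvl m (s + r)))"
    using assms
  proof (induction m rule: dec_induct)
    case base
    show ?case
      by (rule exI[of _ "{0}"]) auto
  next
    case (step m)
    then obtain D where D: "finite D"
      "\<And>s. s \<in> D \<Longrightarrow> \<exists>\<delta>. \<forall>r<Ht n. s + r < Ht m \<and> lv m (s + r) = lv n r + \<delta>"
      "\<And>r. r < Ht n \<Longrightarrow> lvl n r = (\<Union>s\<in>D. lvl m (s + r))"
      by auto
    \<comment> \<open>Each copy of \<open>G\<^sub>n\<close> in \<open>G\<^sub>m\<close> yields one
      copy in each of the four subcolumns.\<close>
    define D' where "D' = (\<lambda>(i, s). off m i + s) ` ({..<4} \<times> D)"
    have "finite D'"
      using D(1) by (simp add: D'_def)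
    moreover have "\<exists>\<delta>. \<forall>r<Ht n. t + r < Ht (Suc m) \<and> lv (Suc m) (t + r) = lv n r + \<delta>"
      if "t \<in> D'" for t
    proof -
      obtain i s where st: "i < 4" "s \<in> D" "t = off m i + s"
        using \<open>t \<in> D'\<close> by (auto simp: D'_def)
      obtain \<delta> where \<delta>: "\<And>r. r < Ht n \<Longrightarrow> s + r < Ht m \<and> lv m (s + r) = lv n r + \<delta>"
        using D(2)[OF st(2)] by blast
      have "t + r < Ht (Suc m) \<and> lv (Suc m) (t + r) = lv n r + (\<delta> + real i * wd (Suc m))"
        if "r < Ht n" for r
        using \<delta>[OF that] off_less[OF st(1), of "s + r" m] lev_off[OF st(1), of "s + r" m]
        by (simp add: st(3) add.assoc del: lev.simps H.simps)
      then show ?thesis by blast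
    qed
    moreover have "lvl n r = (\<Union>t\<in>D'. lvl (Suc m) (t + r))" if r: "r < Ht n" for r
    proof -
      have "lvl m (s + r) = (\<Union>i<4. lvl (Suc m) (off m i + s + r))" if "s \<in> D" for s
      proof -
        have "s + r < Ht m" using D(2)[OF that] r by blast
        then show ?thesis
          using lvl_off_subset[of _ "s + r" m]
          by (auto simp: add.assoc) (metis lvl_split lessThan_iff)
      qed
      then show ?thesis
        using D(3)[OF r] by (auto simp: D'_def)
    qed
    ultimately show ?case by blast
  qed
  then show ?thesis using that by blast
qed

section \<open>The map and its inverse as translations between levels\<close>

text \<open>The point lies in one copy of \<open>G\<^sub>n\<close> inside \<open>G\<^sub>m\<close>,
  and a copy keeps the relative position of its levels.\<close>

lemma lev_diff_refine:
  assumes "n \<le> m" "Suc j < Ht n" "x \<in> lvl n j"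
  shows "\<exists>k. Suc k < Ht m \<and> x \<in> lvl m k \<and> lv m (Suc k) - lv m k = lv n (Suc j) - lv n j"
proof -
  obtain D where D: "finite D"
    "\<And>s. s \<in> D \<Longrightarrow> \<exists>\<delta>. \<forall>r<Ht n. s + r < Ht m \<and> lv m (s + r) = lv n r + \<delta>"
    "\<And>r. r < Ht n \<Longrightarrow> lvl n r = (\<Union>s\<in>D. lvl m (s + r))"
    using lvl_copies[OF assms(1)] by blast
  obtain s where s: "s \<in> D" "x \<in> lvl m (s + j)"
    using D(3)[of j] assms by auto
  obtain \<delta> where \<delta>: "\<And>r. r < Ht n \<Longrightarrow> s + r < Ht m \<and> lv m (s + r) = lv n r + \<delta>"
    using D(2)[OF s(1)] by blast
  then show ?thesis
    using \<delta>[of j] \<delta>[of "Suc j"] assms s by (intro exI[of _ "s + j"]) auto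
qed

text \<open>At the common stage \<open>max n n'\<close> levels are disjoint, so equal points, or
  equal images, determine the level. The first alternative of the last assumption makes
  \<open>T\<close> well defined, the second one \<open>T'\<close>.\<close>

lemma lev_diff_unique:
  assumes "Suc j < Ht n" "x \<in> lvl n j" "Suc j' < Ht n'" "y \<in> lvl n' j'"
    and "x = y \<or> x + lv n (Suc j) - lv n j = y + lv n' (Suc j') - lv n' j'"
  shows "lv n (Suc j) - lv n j = lv n' (Suc j') - lv n' j'"
proof -
  obtain k where k: "Suc k < Ht (max n n')" "x \<in> lvl (max n n') k"
      "lv (max n n') (Suc k) - lv (max n n') k = lv n (Suc j) - lv n j"
    using lev_diff_refine[of n "max n n'"] assms by auto
  obtain l where l: "Suc l < Ht (max n n')" "y \<in> lvl (max n n') l"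
      "lv (max n n') (Suc l) - lv (max n n') l = lv n' (Suc j') - lv n' j'"
    using lev_diff_refine[of n' "max n n'"] assms by auto
  have "x + lv n (Suc j) - lv n j \<in> lvl (max n n') (Suc k)"
    using k unfolding lvl_def by auto
  moreover have "y + lv n' (Suc j') - lv n' j' \<in> lvl (max n n') (Suc l)"
    using l unfolding lvl_def by auto
  ultimately have "k = l"
    using assms(5) lvl_unique[OF _ _ k(2), of l] lvl_unique[OF k(1) l(1)] k l by auto
  then show ?thesis
    using k l by simp
qed

text \<open>Whatever pair \<open>SOME\<close> picks in the definition,
  \<open>lev_diff_unique\<close> gives it the same translation.\<close>

lemma Tmap_lvl:
  assumes "Suc j < Ht n" "x \<in> lvl n j"
  shows "T x = x + lv n (Suc j) - lv n j"
proof -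
  let ?P = "\<lambda>(n, j). Suc j < Ht n \<and> in_level a b c d n j x"
  have P: "?P (n, j)"
    using assms by (simp add: in_level_iff)
  obtain n' j' where nj: "(SOME z. ?P z) = (n', j')"
    by fastforce
  have "?P (n', j')"
    using someI[of ?P, OF P] unfolding nj .
  then have "lv n (Suc j) - lv n j = lv n' (Suc j') - lv n' j'"
    using lev_diff_unique[OF assms, of j' n' x] by (auto simp: in_level_iff)
  moreover have "T x = x + lv n' (Suc j') - lv n' j'"
    using P nj unfolding Tmap_def by auto
  ultimately show ?thesis by simp
qed

lemma Tinv_lvl:
  assumes "Suc j < Ht n" "x \<in> lvl n (Suc j)"
  shows "T' x = x + lv n j - lv n (Suc j)"
proof -
  let ?P = "\<lambda>(n, j). 0 < j \<and> in_level a b c d n j x"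
  have P: "?P (n, Suc j)"
    using assms by (simp add: in_level_iff)
  obtain n' j' where nj: "(SOME z. ?P z) = (n', j')"
    by fastforce
  have P': "?P (n', j')"
    using someI[of ?P, OF P] unfolding nj .
  then obtain i where i: "j' = Suc i"
    by (auto simp: gr0_conv_Suc)
  have "x + lv n j - lv n (Suc j) \<in> lvl n j" "x + lv n' i - lv n' (Suc i) \<in> lvl n' i"
    using assms P' by (auto simp: in_level_iff lvl_def i)
  then have "lv n (Suc j) - lv n j = lv n' (Suc i) - lv n' i"
    using lev_diff_unique[OF assms(1), of _ i n'] P' by (auto simp: in_level_iff i)
  moreover have "T' x = x + lv n' (j' - 1) - lv n' j'"
    using P nj unfolding Tinv_def by auto
  ultimately show ?thesis by (simp add: i)
qed

lemma Tmap_funpow_lvl: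
  "j + t < Ht n \<Longrightarrow> x \<in> lvl n j \<Longrightarrow> (T ^^ t) x = x + (lv n (j + t) - lv n j)"
proof (induction t)
  case (Suc t)
  then have "(T ^^ t) x = x + (lv n (j + t) - lv n j)" by simp
  moreover from this have "(T ^^ t) x \<in> lvl n (j + t)"
    using Suc.prems by (auto simp: lvl_def)
  ultimately show ?case
    using Tmap_lvl[of "j + t" n "(T ^^ t) x"] Suc.prems by simp
qed simp

lemma Tinv_funpow_lvl:
  "j + t < Ht n \<Longrightarrow> x \<in> lvl n (j + t) \<Longrightarrow> (T' ^^ t) x = x + (lv n j - lv n (j + t))"
proof (induction t arbitrary: j)
  case (Suc t)
  then have "(T' ^^ t) x = x + (lv n (Suc j) - lv n (j + Suc t))"
    using Suc.IH[of "Suc j"] by simp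
  moreover from this have "(T' ^^ t) x \<in> lvl n (Suc j)"
    using Suc.prems by (auto simp: lvl_def)
  ultimately show ?case
    using Tinv_lvl[of j n "(T' ^^ t) x"] Suc.prems by simp
qed simp

section \<open>Covering the space by levels, and measurability of the maps\<close>

lemma lvl_subset_box: 
  assumes "j < Ht n" shows "lvl n j \<subseteq> {0..<Ln a b c d n}"
proof -
  have "lv n j \<in> (\<lambda>k. real k * wd n) ` {..<Ht n}"
    using lev_bij[of n] assms by (auto simp: bij_betw_def)
  then obtain k where k: "k < Ht n" "lv n j = real k * wd n" by auto
  have "(real k + 1) * wd n \<le> real (Ht n) * wd n"
    using k(1) wd_pos[of n] by (intro mult_right_mono) auto
  then show ?thesis
    using k wd_pos[of n] by (auto simp: lvl_def Ln_def algebra_simps intro: order.trans[rotated])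
qed

lemma box_cover:
  assumes "x \<in> {0..<Ln a b c d n}"
  obtains j where "j < Ht n" "x \<in> lvl n j"
proof -
  define u where "u = x / wd n"
  have x: "x = u * wd n"
    using wd_pos[of n] by (simp add: u_def)
  have u: "0 \<le> u" "u < real (Ht n)"
    using assms wd_pos[of n] by (auto simp: u_def Ln_def field_simps)
  define k where "k = nat \<lfloor>u\<rfloor>"
  have k: "real k \<le> u" "u < real k + 1"
    using u by (auto simp: k_def)
  then have "k < Ht n" using u by linarith
  then obtain j where j: "j < Ht n" "lv n j = real k * wd n"
    using lev_attained by blast
  have "real k * wd n \<le> u * wd n" "u * wd n < (real k + 1) * wd n"
    using k wd_pos[of n] by auto
  then have "x \<in> lvl n j"
    using j x by (auto simp: lvl_def algebra_simps)
  then show ?thesis using that j by blast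
qed

lemma lvl_subset_X: "j < Ht n \<Longrightarrow> lvl n j \<subseteq> X"
  using lvl_subset_box[of j n] by (auto simp: Xsp_def)

lemma X_cover:
  assumes "x \<in> X"
  obtains n j where "Suc j < Ht n" "x \<in> lvl n j"
proof -
  obtain n where "x \<in> {0..<Ln a b c d n}"
    using assms by (auto simp: Xsp_def)
  then obtain j where j: "j < Ht n" "x \<in> lvl n j"
    by (rule box_cover)
  obtain i where "i < 4" "x \<in> lvl (Suc n) (off n i + j)"
    using lvl_split[OF j] .
  then show ?thesis
    using off_less[of i j n] j that by blast
qed

lemma lvl_measurable: "lvl n j \<in> sets lebesgue"
  by (simp add: lvl_def)

lemma X_measurable: "X \<in> sets lebesgue"
  by (auto simp: Xsp_def)

lemma lev_0: "lv n 0 = 0"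
  by (induction n) (auto simp: Ht_pos Let_def)

lemma Tmap_measurable: "T \<in> measurable (muX a b c d) (muX a b c d)"
  unfolding muX_def
proof (rule piecewise_translation_measurable[OF X_measurable])
  let ?\<P> = "(\<lambda>(n, j). lvl n j) ` {(n, j). Suc j < Ht n}"
  show "T \<in> X \<rightarrow> X"
  proof
    fix x assume "x \<in> X"
    then obtain n j where nj: "Suc j < Ht n" "x \<in> lvl n j"
      by (rule X_cover)
    then have "T x \<in> lvl n (Suc j)"
      using Tmap_lvl[OF nj] by (auto simp: lvl_def)
    then show "T x \<in> X"
      using lvl_subset_X nj by blast
  qed
  show "countable ?\<P>" by simp
  show "X \<subseteq> \<Union>?\<P>"
    by (auto elim!: X_cover)
  show "?\<P> \<subseteq> sets lebesgue"
    using lvl_measurable by auto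
  show "\<exists>v. \<forall>x\<in>P. T x = x + v" if "P \<in> ?\<P>" for P
    using that Tmap_lvl by (auto simp: add_diff_eq[symmetric])
qed

text \<open>The point 0 belongs to the bottom level of every column, hence to no higher one, and
  \<open>Tinv\<close> takes its default value there.\<close>

lemma Tinv_0: "T' 0 = 0"
proof -
  have "\<not> in_level a b c d n j 0" if "0 < j" for n j
    using lvl_unique[of j n 0 0] Ht_pos[of n] that wd_pos[of n]
    by (auto simp: in_level_iff lvl_def lev_0)
  then show ?thesis
    unfolding Tinv_def by auto
qed

text \<open>The bottom level of stage \<open>m\<close> is the interval from 0 to
  \<open>wd m\<close>, which leaves out any given positive point once \<open>m\<close> is
  large.\<close>

lemma X_cover_inv:
  assumes "x \<in> X" "x \<noteq> 0"
  obtains n j where "Suc j < Ht n" "x \<in> lvl n (Suc j)"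
proof -
  obtain n where n: "x \<in> {0..<Ln a b c d n}"
    using assms by (auto simp: Xsp_def)
  then have "0 < x" using assms by auto
  then obtain m where m: "wd m < x"
    using real_arch_pow_inv[of x "1/4"] by (auto simp: wd_def)
  obtain i where i: "i < Ht n" "x \<in> lvl n i"
    using n by (rule box_cover)
  obtain D where D: "\<And>s. s \<in> D \<Longrightarrow> \<exists>\<delta>. \<forall>r<Ht n. s + r < Ht (max n m) \<and> lv (max n m) (s + r) = lv n r + \<delta>"
    "\<And>r. r < Ht n \<Longrightarrow> lvl n r = (\<Union>s\<in>D. lvl (max n m) (s + r))"
    using lvl_copies[of n "max n m"] by (metis max.cobounded1)
  then obtain s where s: "s + i < Ht (max n m)" "x \<in> lvl (max n m) (s + i)"
    using i by blast
  have "s + i \<noteq> 0"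
  proof
    assume "s + i = 0"
    then have "x < wd (max n m)"
      using s(2) by (simp add: lvl_def lev_0)
    also have "\<dots> \<le> wd m"
      by (simp add: wd_def power_decreasing)
    finally show False using m by simp
  qed
  then show ?thesis
    using that[of "s + i - 1" "max n m"] s by simp
qed

lemma Tinv_measurable: "T' \<in> measurable (muX a b c d) (muX a b c d)"
  unfolding muX_def
proof (rule piecewise_translation_measurable[OF X_measurable])
  \<comment> \<open>The singleton takes care of the only point that is in no level above a bottom
    one.\<close>
  let ?\<P> = "insert {0} ((\<lambda>(n, j). lvl n (Suc j)) ` {(n, j). Suc j < Ht n})"
  show "T' \<in> X \<rightarrow> X"
  proof
    fix x assume x: "x \<in> X"
    show "T' x \<in> X"
    proof (cases "x = 0")
      case True
      then show ?thesis using x Tinv_0 by simp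
    next
      case False
      then obtain n j where nj: "Suc j < Ht n" "x \<in> lvl n (Suc j)"
        using X_cover_inv x by blast
      then have "T' x \<in> lvl n j"
        using Tinv_lvl[OF nj] by (auto simp: lvl_def)
      then show ?thesis
        using lvl_subset_X[of j n] nj by auto
    qed
  qed
  show "countable ?\<P>" by simp
  show "X \<subseteq> \<Union>?\<P>"
    by (auto elim!: X_cover_inv)
  show "?\<P> \<subseteq> sets lebesgue"
    using lvl_measurable by auto
  show "\<exists>v. \<forall>x\<in>P. T' x = x + v" if "P \<in> ?\<P>" for P
    using that Tinv_lvl Tinv_0 by (auto simp: add_diff_eq[symmetric])
qed

section \<open>Products of levels and their density in sets of positive measure\<close>

definition sq :: "nat \<Rightarrow> nat \<times> nat \<Rightarrow> (real \<times> real) set" where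
  "sq n u = lvl n (fst u) \<times> lvl n (snd u)"

lemma emeasure_sq: "emeasure lebesgue (sq n u) = ennreal ((wd n)\<^sup>2)"
  using wd_pos[of n]
  by (simp add: sq_def emeasure_lebesgue_Times lvl_measurable del: emeasure_completion)
    (simp add: lvl_def power2_eq_square ennreal_mult)

lemma sq_lmeasurable: "sq n u \<in> lmeasurable"
  using emeasure_sq[of n u]
  by (auto simp: fmeasurable_def sq_def sets_lebesgue_Times lvl_measurable simp del: emeasure_completion)

lemma measure_sq: "measure lebesgue (sq n u) = (wd n)\<^sup>2"
  by (simp add: measure_def emeasure_sq del: emeasure_completion)

text \<open>Distinct squares of one stage are disjoint, so what they miss adds up inside
  \<open>R - A\<close>.\<close>

lemma sum_measure_sq_diff_le:
  assumes "finite I" "inj_on g I"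
    and g: "\<And>z. z \<in> I \<Longrightarrow> fst (g z) < Ht k \<and> snd (g z) < Ht k \<and> sq k (g z) \<subseteq> R"
    and R: "R \<in> lmeasurable" and A: "A \<in> sets lebesgue"
  shows "(\<Sum>z\<in>I. measure lebesgue (sq k (g z) - A)) \<le> measure lebesgue (R - A)"
proof -
  have m: "sq k (g z) - A \<in> lmeasurable" for z
    using sq_lmeasurable A by (rule fmeasurable_Diff)
  have "pairwise (\<lambda>y z. disjnt (sq k (g y) - A) (sq k (g z) - A)) I"
  proof (rule pairwiseI)
    fix y z assume yz: "y \<in> I" "z \<in> I" "y \<noteq> z"
    have "g y = g z" if "w \<in> sq k (g y)" "w \<in> sq k (g z)" for w
      using that g[OF yz(1)] g[OF yz(2)]
      by (auto simp: sq_def intro!: prod_eqI elim: lvl_unique)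
    then show "disjnt (sq k (g y) - A) (sq k (g z) - A)"
      using yz assms(2) by (auto simp: disjnt_def inj_on_def)
  qed
  then have "(\<Sum>z\<in>I. measure lebesgue (sq k (g z) - A)) = measure lebesgue (\<Union>z\<in>I. sq k (g z) - A)"
    using assms(1) m by (intro measure_UNION'[symmetric])
  also have "\<dots> \<le> measure lebesgue (R - A)"
    using g R A assms(1) m sq_lmeasurable
    by (intro measure_mono_fmeasurable fmeasurable_Diff fmeasurableD[OF fmeasurable.finite_UN]) auto
  finally show ?thesis .
qed

lemma Ln_incseq: "incseq (Ln a b c d)"
proof (rule incseq_SucI)
  fix n
  have "real (4 * Ht n) * wd (Suc n) \<le> real (Ht (Suc n)) * wd (Suc n)"
    using wd_pos[of "Suc n"] by (intro mult_right_mono) auto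
  then show "Ln a b c d n \<le> Ln a b c d (Suc n)"
    by (simp add: Ln_def wd_Suc[of n] del: H.simps)
qed

text \<open>A replacement for the density theorem. Take a bounded part \<open>A'\<close> of
  \<open>A\<close> of measure \<open>\<alpha> > 0\<close> and an open \<open>U\<close> around it
  that exceeds it by less than \<open>e * \<alpha> / 2\<close>. The squares inside \<open>U\<close>
  exhaust \<open>A'\<close>, so at all late stages their total area is above
  \<open>\<alpha> / 2\<close>; if each missed at least the fraction \<open>e\<close>, together they
  would miss more than \<open>U - A'\<close> holds. That every late stage works allows two sets to
  be treated at a common stage.\<close>

lemma dense_square:
  assumes A: "A \<in> sets lebesgue" "A \<subseteq> X \<times> X" "emeasure lebesgue A > 0" and e: "e > 0"
  shows "\<exists>n0. \<forall>n\<ge>n0. \<exists>i<Ht n. \<exists>j<Ht n. measure lebesgue (sq n (i, j) - A) < e * (wd n)\<^sup>2"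
proof -
  define bx where "bx m = {0..<Ln a b c d m} \<times> {0..<Ln a b c d m}" for m
  have bx: "bx m \<in> lmeasurable" for m
  proof -
    have "0 \<le> Ln a b c d m"
      by (simp add: Ln_def wd_def)
    then have "emeasure lebesgue (bx m) < \<infinity>"
      unfolding bx_def by (subst emeasure_lebesgue_Times) (auto simp: ennreal_mult_less_top)
    then show ?thesis
      by (auto simp: fmeasurable_def bx_def sets_lebesgue_Times simp del: emeasure_completion)
  qed
  have cover: "A = (\<Union>m. A \<inter> bx m)"
  proof -
    have "z \<in> (\<Union>m. bx m)" if "z \<in> X \<times> X" for z
    proof -
      obtain m m' where "fst z \<in> {0..<Ln a b c d m}" "snd z \<in> {0..<Ln a b c d m'}"
        using \<open>z \<in> X \<times> X\<close> by (auto simp: Xsp_def)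
      then have "z \<in> bx (max m m')"
        using incseqD[OF Ln_incseq, of m "max m m'"] incseqD[OF Ln_incseq, of m' "max m m'"]
        by (auto simp: bx_def mem_Times_iff)
      then show ?thesis by blast
    qed
    then show ?thesis using A(2) by blast
  qed
  obtain m where m: "emeasure lebesgue (A \<inter> bx m) \<noteq> 0"
  proof (rule ccontr)
    assume "\<not> thesis"
    then have "A \<inter> bx m \<in> null_sets lebesgue" for m
      using that A(1) bx by (auto simp: null_sets_def simp del: emeasure_completion)
    then have "(\<Union>m. A \<inter> bx m) \<in> null_sets lebesgue"
      by (rule null_sets_UN)
    then show False
      using A(3) cover by (metis null_setsD1 less_irrefl)
  qed
  define A' where "A' = A \<inter> bx m"
  have A': "A' \<in> lmeasurable"
    unfolding A'_def using fmeasurable_Int_fmeasurable[OF bx A(1)] by (simp add: Int_commute)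
  define \<alpha> where "\<alpha> = measure lebesgue A'"
  have \<alpha>: "\<alpha> > 0"
    using m A' emeasure_eq_measure2[OF A']
    by (auto simp: \<alpha>_def A'_def zero_less_measure_iff simp del: emeasure_completion)
  obtain U where U: "open U" "A' \<subseteq> U" "U - A' \<in> lmeasurable"
      "emeasure lebesgue (U - A') < ennreal (e * \<alpha> / 2)"
    using sets_lebesgue_outer_open[of A' "e * \<alpha> / 2"] A' e \<alpha> by auto
  have UA: "measure lebesgue (U - A') < e * \<alpha> / 2"
    using U(3,4) emeasure_eq_measure2[OF U(3)] e \<alpha> by (simp add: ennreal_less_iff del: emeasure_completion)
  define J where "J n = {(i, j). i < Ht n \<and> j < Ht n \<and> sq n (i, j) \<subseteq> U}" for n
  define V where "V n = (\<Union>u\<in>J n. sq n u)" for n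
  have J: "finite (J n)" for n
    by (rule finite_subset[of _ "{..<Ht n} \<times> {..<Ht n}"]) (auto simp: J_def)
  have V: "V n \<in> lmeasurable" for n
    unfolding V_def using J sq_lmeasurable by (intro fmeasurable.finite_UN) auto
  have "incseq V"
  proof (rule incseq_SucI, rule subsetI)
    fix n z assume "z \<in> V n"
    then obtain i j where ij: "i < Ht n" "j < Ht n" "sq n (i, j) \<subseteq> U" "z \<in> sq n (i, j)"
      by (auto simp: V_def J_def)
    then have "fst z \<in> lvl n i" "snd z \<in> lvl n j"
      by (auto simp: sq_def)
    then obtain k l where k: "k < 4" "fst z \<in> lvl (Suc n) (off n k + i)"
      and l: "l < 4" "snd z \<in> lvl (Suc n) (off n l + j)"
      using lvl_split ij(1,2) by metis
    have "sq (Suc n) (off n k + i, off n l + j) \<subseteq> U"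
      using lvl_off_subset[OF k(1) ij(1)] lvl_off_subset[OF l(1) ij(2)] ij(3)
      by (auto simp: sq_def)
    then have "(off n k + i, off n l + j) \<in> J (Suc n)"
      using off_less[OF k(1) ij(1)] off_less[OF l(1) ij(2)] by (simp add: J_def del: H.simps)
    moreover have "z \<in> sq (Suc n) (off n k + i, off n l + j)"
      using k l by (simp add: sq_def mem_Times_iff)
    ultimately show "z \<in> V (Suc n)"
      unfolding V_def by blast
  qed
  have "A' \<subseteq> (\<Union>n. V n)"
  proof
    fix z assume z: "z \<in> A'"
    then obtain r where r: "r > 0" "ball z r \<subseteq> U"
      using U by (meson openE subsetD)
    then obtain k where k: "wd k < r / 2"
      using real_arch_pow_inv[of "r / 2" "1/4"] by (auto simp: wd_def)
    \<comment> \<open>Stage \<open>m\<close> ensures that the levels reach \<open>z\<close>, stage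
      \<open>k\<close> that the square around \<open>z\<close> is small enough to stay in the
      ball.\<close>
    define n where "n = max m k"
    have "wd n \<le> wd k"
      by (simp add: wd_def n_def power_decreasing)
    then have n: "wd n < r / 2" using k by simp
    have "z \<in> bx n"
      using z incseqD[OF Ln_incseq, of m n] by (auto simp: A'_def bx_def n_def)
    then have "fst z \<in> {0..<Ln a b c d n}" "snd z \<in> {0..<Ln a b c d n}"
      by (auto simp: bx_def)
    then obtain i j where ij: "i < Ht n" "fst z \<in> lvl n i" "j < Ht n" "snd z \<in> lvl n j"
      by (metis box_cover)
    have "sq n (i, j) \<subseteq> ball z r"
    proof
      fix w assume "w \<in> sq n (i, j)"
      then have "dist (fst z) (fst w) < wd n" "dist (snd z) (snd w) < wd n"
        using ij by (auto simp: sq_def lvl_def dist_real_def)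
      moreover have "dist z w \<le> dist (fst z) (fst w) + dist (snd z) (snd w)"
        by (simp add: dist_prod_def sqrt_sum_squares_le_sum)
      ultimately show "w \<in> ball z r" using n by simp
    qed
    then have "(i, j) \<in> J n"
      using ij r by (auto simp: J_def)
    moreover have "z \<in> sq n (i, j)"
      using ij by (simp add: sq_def mem_Times_iff)
    ultimately show "z \<in> (\<Union>n. V n)"
      unfolding V_def by blast
  qed
  then have UN: "(\<Union>n. A' \<inter> V n) = A'" by blast
  have lim: "(\<lambda>n. measure lebesgue (A' \<inter> V n)) \<longlonglongrightarrow> measure lebesgue (\<Union>n. A' \<inter> V n)"
  proof (rule Lim_measure_incseq)
    show "range (\<lambda>n. A' \<inter> V n) \<subseteq> sets lebesgue"
      using A' V by auto
    show "incseq (\<lambda>n. A' \<inter> V n)"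
      using \<open>incseq V\<close> by (auto simp: incseq_def)
    show "emeasure lebesgue (\<Union>n. A' \<inter> V n) \<noteq> \<infinity>"
      unfolding UN infinity_ennreal_def by (rule fmeasurableD2[OF A'])
  qed
  have "eventually (\<lambda>n. \<alpha> / 2 < measure lebesgue (A' \<inter> V n)) sequentially"
  proof (rule order_tendstoD(1)[OF lim])
    have "measure lebesgue (\<Union>n. A' \<inter> V n) = \<alpha>"
      unfolding UN \<alpha>_def by (rule refl)
    then show "\<alpha> / 2 < measure lebesgue (\<Union>n. A' \<inter> V n)"
      using \<alpha> by linarith
  qed
  then obtain n0 where n0: "\<And>n. n \<ge> n0 \<Longrightarrow> \<alpha> / 2 < measure lebesgue (A' \<inter> V n)"
    unfolding eventually_sequentially by blast
  have "\<exists>i<Ht n. \<exists>j<Ht n. measure lebesgue (sq n (i, j) - A) < e * (wd n)\<^sup>2" if "n \<ge> n0" for n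
  proof (rule ccontr)
    assume "\<not> ?thesis"
    then have ge: "e * (wd n)\<^sup>2 \<le> measure lebesgue (sq n u - A)" if "u \<in> J n" for u
      using that unfolding J_def not_less[symmetric] by blast
    have "\<alpha> / 2 < measure lebesgue (A' \<inter> V n)"
      using n0 that by blast
    also have "\<dots> \<le> measure lebesgue (V n)"
      using A' V[of n] by (intro measure_mono_fmeasurable sets.Int fmeasurableD) auto
    also have "\<dots> \<le> (\<Sum>u\<in>J n. measure lebesgue (sq n u))"
      unfolding V_def using J sq_lmeasurable by (intro measure_UNION_le) auto
    also have "\<dots> = (\<Sum>u\<in>J n. (wd n)\<^sup>2)"
      by (simp only: measure_sq)
    finally have "e * (\<alpha> / 2) < e * (\<Sum>u\<in>J n. (wd n)\<^sup>2)"
      using e by simp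
    also have "\<dots> \<le> (\<Sum>u\<in>J n. measure lebesgue (sq n u - A))"
      unfolding sum_distrib_left using ge by (rule sum_mono)
    also have "\<dots> \<le> measure lebesgue (V n - A)"
    proof (rule sum_measure_sq_diff_le[where g = "\<lambda>u. u"])
      show "fst u < Ht n \<and> snd u < Ht n \<and> sq n u \<subseteq> V n" if "u \<in> J n" for u
        using that by (auto simp: V_def J_def)
    qed (use J V A(1) in auto)
    also have "\<dots> \<le> measure lebesgue (U - A')"
      using V[of n] A(1) U(3) by (intro measure_mono_fmeasurable) (auto simp: V_def J_def A'_def)
    finally show False using UA by simp
  qed
  then show ?thesis by blast
qed

section \<open>From moving squares to transitivity\<close>

abbreviation N2 :: "(real \<times> real) measure" where "N2 \<equiv> muX a b c d \<Otimes>\<^sub>M muX a b c d"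

lemma N2_lebesgue:
  assumes "A \<in> sets N2"
  shows "A \<in> sets lebesgue" "emeasure N2 A = emeasure lebesgue A" "A \<subseteq> X \<times> X"
proof -
  show "A \<in> sets lebesgue" "emeasure N2 A = emeasure lebesgue A"
    using sets_restrict_lebesgue_pair[OF X_measurable X_measurable]
      emeasure_restrict_lebesgue_pair[OF X_measurable X_measurable] assms
    unfolding muX_def by blast+
  show "A \<subseteq> X \<times> X"
    using sets.sets_into_space[OF assms] by (simp add: muX_def space_pair_measure space_restrict_space)
qed

definition moves :: "((real \<times> real) \<Rightarrow> (real \<times> real)) \<Rightarrow> nat \<Rightarrow> nat \<times> nat \<Rightarrow> nat \<times> nat \<Rightarrow> bool" where
  "moves F n u v \<longleftrightarrow> (\<forall>z\<in>sq n u. F z = z + (lv n (fst v) - lv n (fst u), lv n (snd v) - lv n (snd u)))"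

lemma measure_sq_le_moves:
  assumes A: "A \<in> sets lebesgue" and B: "B \<in> sets lebesgue" and mv: "moves F n u v"
    and null: "F -` B \<inter> A \<in> null_sets lebesgue"
  shows "(wd n)\<^sup>2 \<le> measure lebesgue (sq n u - A) + measure lebesgue (sq n v - B)"
proof -
  define w where "w = (lv n (fst v) - lv n (fst u), lv n (snd v) - lv n (snd u))"
  let ?P = "sq n u - A" and ?Q = "(+) (- w) ` (sq n v - B)" and ?C = "F -` B \<inter> A"
  have P: "?P \<in> lmeasurable" and Q: "?Q \<in> lmeasurable"
    by (intro fmeasurable_Diff measurable_translation sq_lmeasurable A B)+
  have C: "?C \<in> lmeasurable"
    using null by (auto simp: fmeasurable_def null_sets_def simp del: emeasure_completion)
  have "sq n u \<subseteq> ?P \<union> ?Q \<union> ?C"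
  proof
    fix z assume z: "z \<in> sq n u"
    then have Fz: "F z = z + w"
      using mv by (auto simp: moves_def w_def)
    then have "F z \<in> sq n v"
      using z by (auto simp: sq_def lvl_def w_def)
    moreover have "z = - w + F z"
      using Fz by simp
    ultimately have "F z \<in> B \<or> z \<in> ?Q" by blast
    then show "z \<in> ?P \<union> ?Q \<union> ?C" using z by blast
  qed
  then have "measure lebesgue (sq n u) \<le> measure lebesgue (?P \<union> ?Q \<union> ?C)"
    using P Q C by (intro measure_mono_fmeasurable fmeasurable.Un fmeasurableD sq_lmeasurable)
  also have "\<dots> \<le> measure lebesgue ?P + measure lebesgue ?Q + measure lebesgue ?C"
    using measure_Un_le[of "?P \<union> ?Q" lebesgue ?C] measure_Un_le[of ?P lebesgue ?Q] P Q C by fastforce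
  also have "measure lebesgue ?C = 0"
    using null by (simp add: measure_def null_setsD1 del: emeasure_completion)
  also have "measure lebesgue ?Q = measure lebesgue (sq n v - B)"
    by (rule measure_translation)
  finally show ?thesis by (simp add: measure_sq)
qed

text \<open>If the return set were null, \<open>measure_sq_le_moves\<close> would apply to all
  copies of the two squares in the chosen subcolumns. These copies have total area at least one
  sixteenth of \<open>(wd n)\<^sup>2\<close>, while the two defects, each below one thirty-second of
  it, sum to less.\<close>

lemma positive_return:
  assumes F: "F \<in> measurable N2 N2" and A: "A \<in> sets N2" and B: "B \<in> sets N2"
    and nm: "n \<le> m" and lt: "i < Ht n" "j < Ht n" "i' < Ht n" "j' < Ht n"
    and e: "e < 4" "e' < 4" "f < 4" "f' < 4"
    and dA: "measure lebesgue (sq n (i, j) - A) < (wd n)\<^sup>2 / 32"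
    and dB: "measure lebesgue (sq n (i', j') - B) < (wd n)\<^sup>2 / 32"
    and mv: "\<And>s t. s + i < Ht m \<Longrightarrow> s + i' < Ht m \<Longrightarrow> t + j < Ht m \<Longrightarrow> t + j' < Ht m \<Longrightarrow>
      moves F (Suc m) (off m e + (s + i), off m f + (t + j)) (off m e' + (s + i'), off m f' + (t + j'))"
  shows "emeasure N2 (F -` B \<inter> A) > 0"
proof (rule ccontr)
  assume "\<not> ?thesis"
  moreover have C: "F -` B \<inter> A \<in> sets N2"
  proof -
    have "F -` B \<inter> A = (F -` B \<inter> space N2) \<inter> A"
      using sets.sets_into_space[OF A] by blast
    then show ?thesis using measurable_sets[OF F B] A by simp
  qed
  ultimately have null: "F -` B \<inter> A \<in> null_sets lebesgue"
    using N2_lebesgue[OF C] by (auto simp: null_sets_def simp del: emeasure_completion)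
  note A' = N2_lebesgue(1)[OF A] and B' = N2_lebesgue(1)[OF B]
  obtain D where D: "finite D"
    "\<And>s. s \<in> D \<Longrightarrow> \<exists>\<delta>. \<forall>r<Ht n. s + r < Ht m \<and> lv m (s + r) = lv n r + \<delta>"
    "\<And>r. r < Ht n \<Longrightarrow> lvl n r = (\<Union>s\<in>D. lvl m (s + r))"
    using lvl_copies[OF nm] by blast
  have less: "s + r < Ht m" if "s \<in> D" "r < Ht n" for s r
    using D(2) that by blast
  \<comment> \<open>The copy of the square \<open>l\<close> of \<open>G\<^sub>n\<close> whose
    coordinates lie in the copies of \<open>G\<^sub>n\<close> starting at heights \<open>s\<close>
    and \<open>t\<close> of \<open>G\<^sub>m\<close>, cut down to the pair \<open>k\<close> of
    subcolumns.\<close>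
  define g where "g k l = (\<lambda>(s, t). (off m (fst k) + (s + fst l), off m (snd k) + (t + snd l)))" for k l :: "nat \<times> nat"
  have sum_le: "(\<Sum>z\<in>D \<times> D. measure lebesgue (sq (Suc m) (g k l z) - E)) \<le> measure lebesgue (sq n l - E)"
    if "fst k < 4" "snd k < 4" "fst l < Ht n" "snd l < Ht n" "E \<in> sets lebesgue" for k l E
  proof (rule sum_measure_sq_diff_le)
    show "finite (D \<times> D)" using D by simp
    show "inj_on (g k l) (D \<times> D)" by (auto simp: inj_on_def g_def)
    fix z assume "z \<in> D \<times> D"
    then obtain s t where z: "z = (s, t)" "s \<in> D" "t \<in> D" by auto
    note st = less[OF z(2) that(3)] less[OF z(3) that(4)]
    have "lvl m (s + fst l) \<subseteq> lvl n (fst l)" "lvl m (t + snd l) \<subseteq> lvl n (snd l)"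
      using D(3)[OF that(3)] D(3)[OF that(4)] z by auto
    then have "sq (Suc m) (g k l z) \<subseteq> sq n l"
      using lvl_off_subset[OF that(1) st(1)] lvl_off_subset[OF that(2) st(2)]
      unfolding sq_def g_def z(1) by (simp; blast)
    then show "fst (g k l z) < Ht (Suc m) \<and> snd (g k l z) < Ht (Suc m) \<and> sq (Suc m) (g k l z) \<subseteq> sq n l"
      using off_less[OF that(1) st(1)] off_less[OF that(2) st(2)]
      by (simp add: g_def z(1) del: H.simps)
  qed (use sq_lmeasurable that in auto)
  \<comment> \<open>The copies of a single level cover it, which bounds their number from
    below.\<close>
  have "wd n \<le> real (card D) * wd m"
  proof -
    have "measure lebesgue (lvl n i) \<le> (\<Sum>s\<in>D. measure lebesgue (lvl m (s + i)))"
      unfolding D(3)[OF lt(1)] using D(1) lvl_measurable by (intro measure_UNION_le) auto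
    then show ?thesis
      using wd_pos[of n] wd_pos[of m] by (simp add: lvl_def)
  qed
  then have "(wd n)\<^sup>2 \<le> (real (card D) * wd m)\<^sup>2"
    using wd_pos[of n] by (intro power_mono) auto
  \<comment> \<open>One factor 4 per coordinate, since a subcolumn of \<open>G\<^sub>m\<close> has a
    quarter of its width.\<close>
  also have "\<dots> = 16 * (\<Sum>z\<in>D \<times> D. (wd (Suc m))\<^sup>2)"
    by (simp add: wd_Suc[of m] power2_eq_square card_cartesian_product)
  also have "(\<Sum>z\<in>D \<times> D. (wd (Suc m))\<^sup>2) \<le>
      (\<Sum>z\<in>D \<times> D. measure lebesgue (sq (Suc m) (g (e, f) (i, j) z) - A)
        + measure lebesgue (sq (Suc m) (g (e', f') (i', j') z) - B))"
  proof (rule sum_mono)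
    fix z assume "z \<in> D \<times> D"
    then obtain s t where z: "z = (s, t)" "s \<in> D" "t \<in> D" by auto
    show "(wd (Suc m))\<^sup>2 \<le> measure lebesgue (sq (Suc m) (g (e, f) (i, j) z) - A)
        + measure lebesgue (sq (Suc m) (g (e', f') (i', j') z) - B)"
      using measure_sq_le_moves[OF A' B' mv[of s t] null] less z lt by (simp add: g_def)
  qed
  also have "\<dots> \<le> measure lebesgue (sq n (i, j) - A) + measure lebesgue (sq n (i', j') - B)"
    unfolding sum.distrib using lt e A' B' by (intro add_mono sum_le) auto
  finally show False
    using dA dB by simp
qed

text \<open>The relation \<open>ord\<close> stands for the direction of motion in the first
  coordinate. Subcolumns are chosen twice: at stage \<open>n\<close>, the pairs
  \<open>(e, 0)\<close> for \<open>A\<close> and \<open>(e', 1)\<close> for \<open>B\<close> put the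
  heights in the required order; at stage \<open>m\<close>, the pairs \<open>(e, 2)\<close> and
  \<open>(e', 3)\<close> are where the motion takes place.\<close>

lemma transitive_if_moves:
  assumes S: "S \<in> measurable N2 N2"
    and mv: "\<And>n i i' j j'. ord i i' \<Longrightarrow> j \<le> j' \<Longrightarrow> \<exists>m\<ge>n. \<exists>r\<ge>1. \<forall>s t.
      s + i < Ht m \<longrightarrow> s + i' < Ht m \<longrightarrow> t + j < Ht m \<longrightarrow> t + j' < Ht m \<longrightarrow>
      moves (S ^^ r) (Suc m) (off m e + (s + i), off m 2 + (t + j)) (off m e' + (s + i'), off m 3 + (t + j'))"
    and e: "e < 4" "e' < 4" "\<And>n i i'. i < Ht n \<Longrightarrow> i' < Ht n \<Longrightarrow> ord (off n e + i) (off n e' + i')"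
    and A: "A \<in> sets N2" "emeasure N2 A > 0" and B: "B \<in> sets N2" "emeasure N2 B > 0"
  shows "\<exists>r\<ge>1. emeasure N2 ((S ^^ r) -` B \<inter> A) > 0"
proof -
  note A' = N2_lebesgue[OF A(1)] and B' = N2_lebesgue[OF B(1)]
  obtain n1 where n1: "\<And>n. n \<ge> n1 \<Longrightarrow> \<exists>i<Ht n. \<exists>j<Ht n. measure lebesgue (sq n (i, j) - A) < 1/512 * (wd n)\<^sup>2"
    using dense_square[of A "1/512"] A' A(2) by fastforce
  obtain n2 where n2: "\<And>n. n \<ge> n2 \<Longrightarrow> \<exists>i<Ht n. \<exists>j<Ht n. measure lebesgue (sq n (i, j) - B) < 1/512 * (wd n)\<^sup>2"
    using dense_square[of B "1/512"] B' B(2) by fastforce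
  define n where "n = max n1 n2"
  obtain i j where ij: "i < Ht n" "j < Ht n" "measure lebesgue (sq n (i, j) - A) < 1/512 * (wd n)\<^sup>2"
    using n1[of n] by (auto simp: n_def)
  obtain i' j' where ij': "i' < Ht n" "j' < Ht n" "measure lebesgue (sq n (i', j') - B) < 1/512 * (wd n)\<^sup>2"
    using n2[of n] by (auto simp: n_def)
  \<comment> \<open>One of the 16 subsquares misses no more than the whole square, but its area is
    16 times smaller; hence \<open>1/512\<close>, which is \<open>1/32\<close> divided by
    16.\<close>
  have pass: "measure lebesgue (sq (Suc n) (off n k + u, off n l + v) - E) < (wd (Suc n))\<^sup>2 / 32"
    if "k < 4" "l < 4" "u < Ht n" "v < Ht n" "E \<in> sets lebesgue"
      "measure lebesgue (sq n (u, v) - E) < 1/512 * (wd n)\<^sup>2" for k l u v E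
  proof -
    have "measure lebesgue (sq (Suc n) (off n k + u, off n l + v) - E) \<le> measure lebesgue (sq n (u, v) - E)"
      using lvl_off_subset[OF that(1,3)] lvl_off_subset[OF that(2,4)] that(5) sq_lmeasurable
      by (intro measure_mono_fmeasurable) (auto simp: sq_def intro!: fmeasurable_Diff fmeasurableD)
    also have "\<dots> < 1/512 * (wd n)\<^sup>2" by fact
    finally show ?thesis by (simp add: wd_Suc[of n] power2_eq_square)
  qed
  have "off n 0 + j \<le> off n 1 + j'"
    using ij(2) by (simp add: off_def)
  then obtain m r where m: "m \<ge> Suc n" "r \<ge> 1"
    and M: "\<And>s t. s + (off n e + i) < Ht m \<Longrightarrow> s + (off n e' + i') < Ht m \<Longrightarrow>
      t + (off n 0 + j) < Ht m \<Longrightarrow> t + (off n 1 + j') < Ht m \<Longrightarrow>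
      moves (S ^^ r) (Suc m) (off m e + (s + (off n e + i)), off m 2 + (t + (off n 0 + j)))
        (off m e' + (s + (off n e' + i')), off m 3 + (t + (off n 1 + j')))"
    using mv[OF e(3)[OF ij(1) ij'(1)], of "off n 0 + j" "off n 1 + j'" "Suc n"] by blast
  have "S ^^ r \<in> measurable N2 N2"
    using S by (rule measurable_compose_n)
  then have "emeasure N2 ((S ^^ r) -` B \<inter> A) > 0"
    using pass[OF e(1) _ ij(1,2) A'(1) ij(3), of 0] pass[OF e(2) _ ij'(1,2) B'(1) ij'(3), of 1]
      off_less[OF e(1) ij(1)] off_less[OF e(2) ij'(1)] off_less[of 0 j n] off_less[of 1 j' n] ij(2) ij'(2)
    by (intro positive_return[OF _ A(1) B(1) m(1) _ _ _ _ e(1,2) _ _ _ _ M]) (simp_all del: H.simps)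
  then show ?thesis using m(2) by blast
qed

section \<open>Motions of the two product maps\<close>

lemma moves_Tmap_Tmap:
  assumes "fst v = fst u + p * r" "snd v = snd u + q * r" "fst v < Ht n" "snd v < Ht n"
  shows "moves (map_prod (T ^^ p) (T ^^ q) ^^ r) n u v"
proof -
  have "(map_prod (T ^^ p) (T ^^ q) ^^ r) z = z + (lv n (fst v) - lv n (fst u), lv n (snd v) - lv n (snd u))"
    if "z \<in> sq n u" for z
  proof -
    have "(T ^^ (p * r)) (fst z) = fst z + (lv n (fst v) - lv n (fst u))"
      using Tmap_funpow_lvl[of "fst u" "p * r" n "fst z"] that assms by (simp add: sq_def mem_Times_iff)
    moreover have "(T ^^ (q * r)) (snd z) = snd z + (lv n (snd v) - lv n (snd u))"
      using Tmap_funpow_lvl[of "snd u" "q * r" n "snd z"] that assms by (simp add: sq_def mem_Times_iff)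
    ultimately show ?thesis
      by (cases z) (simp add: map_prod_funpow funpow_mult)
  qed
  then show ?thesis
    unfolding moves_def by blast
qed

lemma moves_Tinv_Tmap:
  assumes "fst u = fst v + p * r" "snd v = snd u + q * r" "fst u < Ht n" "snd v < Ht n"
  shows "moves (map_prod (T' ^^ p) (T ^^ q) ^^ r) n u v"
proof -
  have "(map_prod (T' ^^ p) (T ^^ q) ^^ r) z = z + (lv n (fst v) - lv n (fst u), lv n (snd v) - lv n (snd u))"
    if "z \<in> sq n u" for z
  proof -
    have "(T' ^^ (p * r)) (fst z) = fst z + (lv n (fst v) - lv n (fst u))"
      using Tinv_funpow_lvl[of "fst v" "p * r" n "fst z"] that assms by (simp add: sq_def mem_Times_iff)
    moreover have "(T ^^ (q * r)) (snd z) = snd z + (lv n (snd v) - lv n (snd u))"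
      using Tmap_funpow_lvl[of "snd u" "q * r" n "snd z"] that assms by (simp add: sq_def mem_Times_iff)
    ultimately show ?thesis
      by (cases z) (simp add: map_prod_funpow funpow_mult)
  qed
  then show ?thesis
    unfolding moves_def by blast
qed

lemma map_prod_funpow_measurable:
  assumes "f \<in> measurable (muX a b c d) (muX a b c d)" "g \<in> measurable (muX a b c d) (muX a b c d)"
  shows "map_prod (f ^^ p) (g ^^ q) \<in> measurable N2 N2"
proof -
  have [measurable]: "f ^^ p \<in> measurable (muX a b c d) (muX a b c d)"
      "g ^^ q \<in> measurable (muX a b c d) (muX a b c d)"
    using assms by (auto intro: measurable_compose_n)
  show ?thesis
    unfolding map_prod_def by measurable
qed

text \<open>In the assumption, \<open>k\<close> and \<open>l\<close> absorb the height differences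
  of the levels to be joined, and \<open>m\<close> may be taken beyond any stage at which these
  levels were chosen.\<close>

lemma conservative_ergodic_products:
  assumes hyp: "\<And>k l n. \<exists>m\<ge>n. \<exists>r\<ge>1. p * r = pp a b c d m + k \<and> q * r = qq a b c d m + l"
  shows "conservative N2 (map_prod (T ^^ p) (T ^^ q))" "ergodic N2 (map_prod (T ^^ p) (T ^^ q))"
    "conservative N2 (map_prod (T' ^^ p) (T ^^ q))" "ergodic N2 (map_prod (T' ^^ p) (T ^^ q))"
proof -
  note meas = map_prod_funpow_measurable[OF Tmap_measurable Tmap_measurable, of p q]
    map_prod_funpow_measurable[OF Tinv_measurable Tmap_measurable, of p q]
  \<comment> \<open>The starting heights of the first two subcolumns differ by
    \<open>p\<^sub>m\<close>, those of the last two by \<open>q\<^sub>m\<close>; these are the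
    distances to be travelled in each coordinate, up to \<open>k\<close> and
    \<open>l\<close>.\<close>
  have offs: "off m 1 = off m 0 + pp a b c d m" "off m 3 = off m 2 + qq a b c d m" for m
    by (simp_all add: off_def pp_def qq_def)
  have off_ord: "off n 0 + i \<le> off n 1 + i'" if "i < Ht n" for n i i'
    using that by (simp add: off_def)
  have "\<exists>r\<ge>1. emeasure N2 ((map_prod (T ^^ p) (T ^^ q) ^^ r) -` B \<inter> A) > 0"
    if "A \<in> sets N2" "B \<in> sets N2" "emeasure N2 A > 0" "emeasure N2 B > 0" for A B
  proof (rule transitive_if_moves[OF meas(1), where ord = "(\<le>)" and e = 0 and e' = 1])
    fix n i i' j j' :: nat assume le: "i \<le> i'" "j \<le> j'"
    obtain m r where m: "m \<ge> n" "r \<ge> 1"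
      and pq: "p * r = pp a b c d m + (i' - i)" "q * r = qq a b c d m + (j' - j)"
      using hyp by blast
    have "moves (map_prod (T ^^ p) (T ^^ q) ^^ r) (Suc m)
        (off m 0 + (s + i), off m 2 + (t + j)) (off m 1 + (s + i'), off m 3 + (t + j'))"
      if "s + i' < Ht m" "t + j' < Ht m" for s t
      using that le pq offs off_less[of 1 "s + i'" m] off_less[of 3 "t + j'" m]
      by (intro moves_Tmap_Tmap) (auto simp del: H.simps)
    then show "\<exists>m\<ge>n. \<exists>r\<ge>1. \<forall>s t.
      s + i < Ht m \<longrightarrow> s + i' < Ht m \<longrightarrow> t + j < Ht m \<longrightarrow> t + j' < Ht m \<longrightarrow>
      moves (map_prod (T ^^ p) (T ^^ q) ^^ r) (Suc m)
        (off m 0 + (s + i), off m 2 + (t + j)) (off m 1 + (s + i'), off m 3 + (t + j'))"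
      using m by blast
  qed (use that off_ord in auto)
  then show "conservative N2 (map_prod (T ^^ p) (T ^^ q))" "ergodic N2 (map_prod (T ^^ p) (T ^^ q))"
    using conservative_ergodic_if_transitive[OF meas(1)] by blast+
  \<comment> \<open>The inverse travels downwards in the first coordinate, so subcolumns 0 and 1
    exchange roles and the order is reversed.\<close>
  have "\<exists>r\<ge>1. emeasure N2 ((map_prod (T' ^^ p) (T ^^ q) ^^ r) -` B \<inter> A) > 0"
    if "A \<in> sets N2" "B \<in> sets N2" "emeasure N2 A > 0" "emeasure N2 B > 0" for A B
  proof (rule transitive_if_moves[OF meas(2), where ord = "(\<ge>)" and e = 1 and e' = 0])
    fix n i i' j j' :: nat assume le: "i \<ge> i'" "j \<le> j'"
    obtain m r where m: "m \<ge> n" "r \<ge> 1"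
      and pq: "p * r = pp a b c d m + (i - i')" "q * r = qq a b c d m + (j' - j)"
      using hyp by blast
    have "moves (map_prod (T' ^^ p) (T ^^ q) ^^ r) (Suc m)
        (off m 1 + (s + i), off m 2 + (t + j)) (off m 0 + (s + i'), off m 3 + (t + j'))"
      if "s + i < Ht m" "t + j' < Ht m" for s t
      using that le pq offs off_less[of 1 "s + i" m] off_less[of 3 "t + j'" m]
      by (intro moves_Tinv_Tmap) (auto simp del: H.simps)
    then show "\<exists>m\<ge>n. \<exists>r\<ge>1. \<forall>s t.
      s + i < Ht m \<longrightarrow> s + i' < Ht m \<longrightarrow> t + j < Ht m \<longrightarrow> t + j' < Ht m \<longrightarrow>
      moves (map_prod (T' ^^ p) (T ^^ q) ^^ r) (Suc m)
        (off m 1 + (s + i), off m 2 + (t + j)) (off m 0 + (s + i'), off m 3 + (t + j'))"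
      using m by blast
  qed (use that off_ord in auto)
  then show "conservative N2 (map_prod (T' ^^ p) (T ^^ q))" "ergodic N2 (map_prod (T' ^^ p) (T ^^ q))"
    using conservative_ergodic_if_transitive[OF meas(2)] by blast+
qed

end

theorem mainTheorem1:
  fixes a b c d :: "nat \<Rightarrow> nat" and p q :: nat
  assumes pos: "\<And>n. a n > 0" "\<And>n. b n > 0" "\<And>n. c n > 0" "\<And>n. d n > 0"
    and W: "inW a b c d"
    and pq: "p > 0" "q > 0"
    and hyp: "\<And>k l :: nat. infinite {n. \<exists>r :: nat.
                 real (qq a b c d n + l) / real q = real r \<and>
                 real (pp a b c d n + k) / real p = real r}"
  shows "conservative (muX a b c d \<Otimes>\<^sub>M muX a b c d) (map_prod (Tmap a b c d ^^ p) (Tmap a b c d ^^ q))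
       \<and> ergodic (muX a b c d \<Otimes>\<^sub>M muX a b c d) (map_prod (Tmap a b c d ^^ p) (Tmap a b c d ^^ q))
       \<and> conservative (muX a b c d \<Otimes>\<^sub>M muX a b c d) (map_prod (Tinv a b c d ^^ p) (Tmap a b c d ^^ q))
       \<and> ergodic (muX a b c d \<Otimes>\<^sub>M muX a b c d) (map_prod (Tinv a b c d ^^ p) (Tmap a b c d ^^ q))"
proof -
  interpret rank_one a b c d
    by standard (rule pos(4))
  have "\<exists>m\<ge>n. \<exists>r\<ge>1. p * r = pp a b c d m + k \<and> q * r = qq a b c d m + l" for k l n
  proof -
    \<comment> \<open>An infinite set of naturals has an element beyond any
      \<open>n\<close>.\<close>
    obtain m r where m: "m \<ge> n" and r: "real (qq a b c d m + l) / real q = real r"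
        "real (pp a b c d m + k) / real p = real r"
      using hyp[where k = k and l = l] unfolding infinite_nat_iff_unbounded_le by blast
    have "real (p * r) = real (pp a b c d m + k)" "real (q * r) = real (qq a b c d m + l)"
      using r pq by (auto simp: field_simps)
    then have *: "p * r = pp a b c d m + k" "q * r = qq a b c d m + l"
      by (simp_all only: of_nat_eq_iff)
    \<comment> \<open>The value \<open>r = 0\<close> would force \<open>p\<^sub>m + k = 0\<close>,
      although \<open>p\<^sub>m\<close> is positive.\<close>
    moreover have "r \<ge> 1"
      using * pos(1)[of m] by (cases r) (auto simp: pp_def)
    ultimately show ?thesis using m by blast
  qed
  then show ?thesis
    by (intro conjI conservative_ergodic_products)
qed

end
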